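(* Let $G=(V,E)$ be a finite undirected graph (multiple edges and loops allowed), let $q$ be an arbitrary (complex) number, and let $\bm v=(v_e)_{e\in E}$ and $\bm u=(u_e)_{e\in E}$ be arbitrary sequences of (complex) numbers indexed by $E$. Then the following two identities hold. (1) If $v_e\neq 0$ and $u_e\neq 0$ for all $e\in E$, then $$Z(G;q,\bm v)=\Big(\prod_{e\in E}\frac{v_e}{u_e}\Big)\sum_{F\subseteq E}\Big(\prod_{e\in F}\Big(\frac{u_e}{v_e}-1\Big)\Big)\,Z\big(G-F;q,(u_e)_{e\in E-F}\big).$$ (2) With no nonvanishing assumption, $$Z(G;q,\bm v)=\sum_{F\subseteq E}\Big(\prod_{e\in F}(v_e-u_e)\Big)\,Z\big(G/F;q,(u_e)_{e\in E-F}\big).$$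
   Context: Graphs are finite, undirected, and may have loops and multiple edges. For a graph $G=(V,E)$, a number $q$ and a sequence $\bm v=(v_e)_{e\in E}$ of numbers, the Potts model partition function (multivariate Tutte polynomial) is $$Z(G;q,\bm v)=\sum_{A\subseteq E}q^{k_G(A)}\prod_{e\in A}v_e,$$ where $k_G(A)$ is the number of connected components of the spanning subgraph $(V,A)$. Empty products equal $1$. For $F\subseteq E$: $G-F=(V,E-F)$ is the graph obtained by deleting all edges in $F$ (keeping all vertices). $G/F$ is the graph with edge set $E-F$ obtained by contracting all edges in $F$; that is, its vertices are the connected components of $(V,F)$, and each edge $e\in E-F$ joins the components containing its endpoints. Loops and multiple edges arising from contraction are kept. *)

theory Defs
  imports Complex_Main "HOL-Library.Uprod"
begin

text \<open>
  Undirected multigraphs: edges are abstract labels, and each edge is mapped to the unordered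
  pair of its endpoints, where \<open>Upair x x\<close> is a loop at \<open>x\<close>. The values of \<open>ends\<close> outside the
  edge set carry no information.
\<close>

record ('v, 'e) multigraph =
  verts :: "'v set"
  edges :: "'e set"
  ends  :: "'e \<Rightarrow> 'v uprod"

definition finite_multigraph :: "('v, 'e) multigraph \<Rightarrow> bool" where
  "finite_multigraph G \<longleftrightarrow>
     finite (verts G) \<and> finite (edges G) \<and> (\<forall>e\<in>edges G. set_uprod (ends G e) \<subseteq> verts G)"

definition adj_rel :: "('v, 'e) multigraph \<Rightarrow> ('v \<times> 'v) set" where
  "adj_rel G = {(x, y). \<exists>e\<in>edges G. ends G e = Upair x y}"

definition connected_rel :: "('v, 'e) multigraph \<Rightarrow> ('v \<times> 'v) set" where
  "connected_rel G = {(x, y). x \<in> verts G \<and> y \<in> verts G \<and> (x, y) \<in> (adj_rel G)\<^sup>*}"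

text \<open>Components are represented by their vertex sets.\<close>

definition component_of :: "('v, 'e) multigraph \<Rightarrow> 'v \<Rightarrow> 'v set" where
  "component_of G x = connected_rel G `` {x}"

definition components :: "('v, 'e) multigraph \<Rightarrow> 'v set set" where
  "components G = component_of G ` verts G"

definition spanning_subgraph :: "('v, 'e) multigraph \<Rightarrow> 'e set \<Rightarrow> ('v, 'e) multigraph" where
  "spanning_subgraph G A = \<lparr>verts = verts G, edges = A, ends = ends G\<rparr>"

definition num_components :: "('v, 'e) multigraph \<Rightarrow> 'e set \<Rightarrow> nat" where
  "num_components G A = card (components (spanning_subgraph G A))"

definition Potts_Z :: "('v, 'e) multigraph \<Rightarrow> complex \<Rightarrow> ('e \<Rightarrow> complex) \<Rightarrow> complex" where
  "Potts_Z G q v = (\<Sum>A\<in>Pow (edges G). q ^ num_components G A * (\<Prod>e\<in>A. v e))"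

definition delete_edges :: "('v, 'e) multigraph \<Rightarrow> 'e set \<Rightarrow> ('v, 'e) multigraph" where
  "delete_edges G F = spanning_subgraph G (edges G - F)"

definition contract_edges :: "('v, 'e) multigraph \<Rightarrow> 'e set \<Rightarrow> ('v set, 'e) multigraph" where
  "contract_edges G F =
     \<lparr>verts = components (spanning_subgraph G F),
      edges = edges G - F,
      ends = (\<lambda>e. map_uprod (component_of (spanning_subgraph G F)) (ends G e))\<rparr>"

lemma finite_multigraph_delete_edges:
  "finite_multigraph G \<Longrightarrow> finite_multigraph (delete_edges G F)"
  by (auto simp: finite_multigraph_def delete_edges_def spanning_subgraph_def)

lemma finite_multigraph_contract_edges:
  "finite_multigraph G \<Longrightarrow> finite_multigraph (contract_edges G F)"
  by (force simp: finite_multigraph_def contract_edges_def components_def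
      spanning_subgraph_def uprod.set_map)

end

theory Submission
  imports Defs
begin

text \<open>
  Write each side as a double sum over disjoint pairs \<open>(F, A)\<close> of edge sets. For the deletion identity,
  fix \<open>A\<close> and sum over \<open>F \<subseteq> E - A\<close>; for the contraction identity, use
  \<open>k_{G/F}(A) = k_G(F \<union> A)\<close>, fix \<open>B = F \<union> A\<close> and sum over \<open>F \<subseteq> B\<close>. In both cases the
  inner sum is the expansion of a product of binomials.
\<close>

lemma adj_rel_spanning_subgraph:
  "adj_rel (spanning_subgraph G A) = {(x, y). \<exists>e\<in>A. ends G e = Upair x y}"
  by (simp add: adj_rel_def spanning_subgraph_def)

lemma verts_spanning_subgraph [simp]: "verts (spanning_subgraph G A) = verts G"
  by (simp add: spanning_subgraph_def)

lemma sym_adj_rel: "sym (adj_rel G)"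
  unfolding adj_rel_def sym_def using Upair_inject by fastforce

lemma equiv_connected_rel: "equiv (verts G) (connected_rel G)"
proof (rule equivI)
  show "connected_rel G \<subseteq> verts G \<times> verts G"
    by (auto simp: connected_rel_def)
  show "refl_on (verts G) (connected_rel G)"
    by (auto simp: refl_on_def connected_rel_def)
  show "sym (connected_rel G)"
    using sym_rtrancl[OF sym_adj_rel[of G]] by (auto simp: sym_def connected_rel_def)
  show "trans (connected_rel G)"
    by (auto simp: trans_def connected_rel_def)
qed

text \<open>Components are the classes of an equivalence relation on the vertices. Equality of these
  sets can thus be traded for reachability, and counting components reduces to comparing
  paths.\<close>

lemma component_of_eq_iff:
  assumes "x \<in> verts G" "y \<in> verts G"
  shows "component_of G x = component_of G y \<longleftrightarrow> (x, y) \<in> (adj_rel G)\<^sup>*"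
  using eq_equiv_class_iff[OF equiv_connected_rel assms] assms
  by (simp add: component_of_def connected_rel_def)

text \<open>Paths project and lift along \<open>c\<close>. A path using edges of
  \<open>F \<union> A\<close> maps to a path in the contraction. Conversely, each edge of a path in
  the contraction comes from an edge in \<open>A\<close>, and the gap between two consecutive such
  edges lies in one component of \<open>(V, F)\<close>, so edges of \<open>F\<close> bridge
  it.\<close>

lemma adj_rel_contract_edges_iff:
  assumes G: "finite_multigraph G" and F: "F \<subseteq> edges G" and A: "A \<subseteq> edges G"
    and x: "x \<in> verts G" and y: "y \<in> verts G"
  defines "c \<equiv> component_of (spanning_subgraph G F)"
  shows "(c x, c y) \<in> (adj_rel (spanning_subgraph (contract_edges G F) A))\<^sup>* \<longleftrightarrow>
         (x, y) \<in> (adj_rel (spanning_subgraph G (F \<union> A)))\<^sup>*"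
    (is "_ \<in> ?R\<^sup>* \<longleftrightarrow> _ \<in> ?S\<^sup>*")
proof
  have R: "?R = {(X, Y). \<exists>e\<in>A. map_uprod c (ends G e) = Upair X Y}"
    by (simp add: adj_rel_spanning_subgraph contract_edges_def c_def)
  have S: "?S = {(x, y). \<exists>e\<in>F \<union> A. ends G e = Upair x y}"
    by (rule adj_rel_spanning_subgraph)
  have ends: "a \<in> verts G \<and> b \<in> verts G" if "e \<in> edges G" "ends G e = Upair a b" for a b e
    using G that by (force simp: finite_multigraph_def)
  have symS: "sym (?S\<^sup>*)"
    by (rule sym_rtrancl[OF sym_adj_rel])
  have c_eq: "c a = c b \<longleftrightarrow> (a, b) \<in> (adj_rel (spanning_subgraph G F))\<^sup>*"
    if "a \<in> verts G" "b \<in> verts G" for a b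
    using that unfolding c_def by (intro component_of_eq_iff) auto
  have mono: "(adj_rel (spanning_subgraph G F))\<^sup>* \<subseteq> ?S\<^sup>*"
    by (rule rtrancl_mono) (auto simp: adj_rel_spanning_subgraph)
  {
    assume "(x, y) \<in> ?S\<^sup>*"
    then show "(c x, c y) \<in> ?R\<^sup>*"
    proof (induction rule: rtrancl_induct)
      case (step a b)
      then obtain e where e: "e \<in> F \<union> A" "ends G e = Upair a b"
        by (auto simp: S)
      \<comment> \<open>An edge of \<open>F\<close> lies inside one component of
        \<open>(V, F)\<close>, so its image is a single vertex; any other edge is in
        \<open>A\<close> and survives the contraction, possibly as a loop.\<close>
      show ?case
      proof (cases "e \<in> F")
        case True
        then have "(a, b) \<in> (adj_rel (spanning_subgraph G F))\<^sup>*"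
          using e by (auto simp: adj_rel_spanning_subgraph)
        moreover have "a \<in> verts G" "b \<in> verts G"
          using ends e F True by blast+
        ultimately have "c a = c b"
          using c_eq by blast
        then show ?thesis
          using step.IH by simp
      next
        case False
        then have "(c a, c b) \<in> ?R"
          using e unfolding R by (auto intro!: bexI[of _ e])
        then show ?thesis
          using step.IH by (rule rtrancl_into_rtrancl[rotated])
      qed
    qed simp
  }
  \<comment> \<open>The representative \<open>z\<close> of the last vertex \<open>Z\<close> is kept
    arbitrary: the next lifted edge may leave the component \<open>Z\<close> from any of its
    vertices, and the induction hypothesis has to apply to that one.\<close>
  have lift: "(x, z) \<in> ?S\<^sup>*" if "(c x, Z) \<in> ?R\<^sup>*" "Z = c z" "z \<in> verts G" for Z z
    using that
  proof (induction arbitrary: z rule: rtrancl_induct)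
    case base
    then show ?case using c_eq x mono by blast
  next
    case (step Y Z)
    then obtain e where e: "e \<in> A" "map_uprod c (ends G e) = Upair Y Z"
      by (auto simp: R)
    obtain a b where ab: "ends G e = Upair a b"
      by (cases "ends G e")
    have V: "a \<in> verts G" "b \<in> verts G"
      using ends ab e A by blast+
    have abS: "(a, b) \<in> ?S\<^sup>*" "(b, a) \<in> ?S\<^sup>*"
      using e ab symS by (auto simp: S sym_def)
    \<comment> \<open>Stated for abstract \<open>a'\<close> and \<open>b'\<close> because endpoints
      are unordered: the lifted edge may run along the path in either direction. Its far end
      \<open>b'\<close> is joined to \<open>z\<close> within \<open>F\<close>, both lying in
      \<open>Z\<close>.\<close>
    have reach: "(x, z) \<in> ?S\<^sup>*"
      if "c a' = Y" "c b' = Z" "a' \<in> verts G" "b' \<in> verts G" "(a', b') \<in> ?S\<^sup>*" for a' b'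
    proof -
      have "(x, a') \<in> ?S\<^sup>*" using step.IH that by simp
      moreover have "(b', z) \<in> ?S\<^sup>*"
        using c_eq[of b' z] that step.prems mono by auto
      ultimately show ?thesis using that by (meson rtrancl_trans)
    qed
    from e ab have "c a = Y \<and> c b = Z \<or> c a = Z \<and> c b = Y"
      by auto
    then show ?case using reach V abS by blast
  qed
  show "(x, y) \<in> ?S\<^sup>*" if "(c x, c y) \<in> ?R\<^sup>*"
    using lift that y by blast
qed

text \<open>Taking images under \<open>?c\<close> is a bijection from the components of
  \<open>(V, F \<union> A)\<close> to those of the contraction, since \<open>?c\<close> both
  preserves and reflects reachability.\<close>

lemma num_components_contract_edges:
  assumes G: "finite_multigraph G" and F: "F \<subseteq> edges G" and A: "A \<subseteq> edges G"
  shows "num_components (contract_edges G F) A = num_components G (F \<union> A)"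
proof -
  let ?c = "component_of (spanning_subgraph G F)"
  let ?K = "spanning_subgraph (contract_edges G F) A"
  let ?H = "spanning_subgraph G (F \<union> A)"
  have VK: "verts (contract_edges G F) = ?c ` verts G"
    by (simp add: contract_edges_def components_def)
  have adj: "(?c x, ?c y) \<in> (adj_rel ?K)\<^sup>* \<longleftrightarrow> (x, y) \<in> (adj_rel ?H)\<^sup>*"
    if "x \<in> verts G" "y \<in> verts G" for x y
    using adj_rel_contract_edges_iff[OF G F A that] .
  \<comment> \<open>By \<open>VK\<close> every vertex of the contraction has the form
    \<open>?c y\<close>, so reachability from \<open>?c x\<close> can be decided in
    \<open>?H\<close>.\<close>
  have comp: "component_of ?K (?c x) = ?c ` component_of ?H x" if "x \<in> verts G" for x
    using that by (auto simp: component_of_def[of ?K] component_of_def[of ?H]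
        connected_rel_def[of ?K] connected_rel_def[of ?H] VK adj)
  have eq: "components ?K = image ?c ` components ?H"
    by (simp add: components_def[of ?K] components_def[of ?H] VK image_image comp cong: image_cong)
  have "inj_on (image ?c) (components ?H)"
  proof (rule inj_onI)
    fix C D assume "C \<in> components ?H" "D \<in> components ?H" "?c ` C = ?c ` D"
    then obtain x y where x: "x \<in> verts G" "C = component_of ?H x"
      and y: "y \<in> verts G" "D = component_of ?H y"
      by (auto simp: components_def)
    with \<open>?c ` C = ?c ` D\<close> have "component_of ?K (?c x) = component_of ?K (?c y)"
      by (simp add: comp)
    then have "(?c x, ?c y) \<in> (adj_rel ?K)\<^sup>*"
      using component_of_eq_iff[of "?c x" ?K "?c y"] x y by (simp add: VK)
    then show "C = D"
      using x y adj component_of_eq_iff[of x ?H y] by simp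
  qed
  then show ?thesis
    by (simp add: num_components_def eq card_image)
qed

lemma Potts_Z_delete_edges:
  "Potts_Z (delete_edges G F) q u =
    (\<Sum>A\<in>Pow (edges G - F). q ^ num_components G A * (\<Prod>e\<in>A. u e))"
  by (simp add: Potts_Z_def delete_edges_def num_components_def spanning_subgraph_def)

lemma Potts_Z_contract_edges:
  assumes "finite_multigraph G" "F \<subseteq> edges G"
  shows "Potts_Z (contract_edges G F) q u =
    (\<Sum>A\<in>Pow (edges G - F). q ^ num_components G (F \<union> A) * (\<Prod>e\<in>A. u e))"
proof -
  have "edges (contract_edges G F) = edges G - F"
    by (simp add: contract_edges_def)
  then show ?thesis
    unfolding Potts_Z_def
    by (intro sum.cong refl arg_cong2[of _ _ _ _ "(*)"] arg_cong[of _ _ "power q"])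
      (use assms in \<open>auto intro!: num_components_contract_edges\<close>)
qed

text \<open>Both sides run over the ordered pairs of disjoint subsets of \<open>E\<close>, and
  disjointness is symmetric.\<close>

lemma sum_disjoint_Pow_swap:
  fixes f :: "'a set \<Rightarrow> 'a set \<Rightarrow> 'b::comm_monoid_add"
  assumes "finite E"
  shows "(\<Sum>F\<in>Pow E. \<Sum>A\<in>Pow (E - F). f F A) = (\<Sum>A\<in>Pow E. \<Sum>F\<in>Pow (E - A). f F A)"
proof -
  have "Pow (E - X) = {Y\<in>Pow E. X \<inter> Y = {}}" "Pow (E - X) = {Y\<in>Pow E. Y \<inter> X = {}}" for X
    by auto
  then show ?thesis
    using sum.swap_restrict[of "Pow E" "Pow E" f "\<lambda>F A. F \<inter> A = {}"] assms by simp
qed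

text \<open>Disjoint pairs \<open>(F, A)\<close> correspond to nested pairs
  \<open>F \<subseteq> B\<close> through \<open>B = F \<union> A\<close>, with inverse
  \<open>A = B - F\<close>.\<close>

lemma sum_disjoint_Pow_Un:
  fixes f :: "'a set \<Rightarrow> 'a set \<Rightarrow> 'b::comm_monoid_add"
  assumes "finite E"
  shows "(\<Sum>F\<in>Pow E. \<Sum>A\<in>Pow (E - F). f F A) = (\<Sum>B\<in>Pow E. \<Sum>F\<in>Pow B. f F (B - F))"
proof -
  have "(\<Sum>F\<in>Pow E. \<Sum>A\<in>Pow (E - F). f F A) = (\<Sum>F\<in>Pow E. \<Sum>B\<in>{B\<in>Pow E. F \<subseteq> B}. f F (B - F))"
  proof (rule sum.cong[OF refl])
    fix F assume "F \<in> Pow E"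
    then show "(\<Sum>A\<in>Pow (E - F). f F A) = (\<Sum>B\<in>{B\<in>Pow E. F \<subseteq> B}. f F (B - F))"
      by (intro sum.reindex_bij_witness[of _ "\<lambda>B. B - F" "\<lambda>A. F \<union> A"])
        (auto intro!: arg_cong[of _ _ "f F"])
  qed
  also have "\<dots> = (\<Sum>B\<in>Pow E. \<Sum>F\<in>{F\<in>Pow E. F \<subseteq> B}. f F (B - F))"
    using assms by (intro sum.swap_restrict) auto
  also have "\<dots> = (\<Sum>B\<in>Pow E. \<Sum>F\<in>Pow B. f F (B - F))"
    by (intro sum.cong) auto
  finally show ?thesis .
qed

theorem theorem1p2:
  fixes G :: "('v, 'e) multigraph"
    and q :: complex
    and v u :: "'e \<Rightarrow> complex"
  assumes "finite_multigraph G"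
  shows "((\<forall>e\<in>edges G. v e \<noteq> 0 \<and> u e \<noteq> 0) \<longrightarrow>
           Potts_Z G q v =
             (\<Prod>e\<in>edges G. v e / u e) *
             (\<Sum>F\<in>Pow (edges G). (\<Prod>e\<in>F. u e / v e - 1) * Potts_Z (delete_edges G F) q u))
       \<and> Potts_Z G q v =
           (\<Sum>F\<in>Pow (edges G). (\<Prod>e\<in>F. v e - u e) * Potts_Z (contract_edges G F) q u)"
proof (intro conjI impI)
  let ?E = "edges G" and ?k = "num_components G"
  have fin: "finite ?E"
    using assms by (simp add: finite_multigraph_def)
  {
    assume nz: "\<forall>e\<in>?E. v e \<noteq> 0 \<and> u e \<noteq> 0"
    \<comment> \<open>Expansion of the product of \<open>(u e / v e - 1) + 1\<close>; the factors 1
      contribute nothing.\<close>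
    have inner: "(\<Sum>F\<in>Pow (?E - A). \<Prod>e\<in>F. u e / v e - 1) = (\<Prod>e\<in>?E - A. u e / v e)" for A
      using prod_add[of "?E - A" "\<lambda>e. u e / v e - 1" "\<lambda>_. 1"] fin by simp
    \<comment> \<open>The prefactor splits over \<open>A\<close> and its complement: outside
      \<open>A\<close> it cancels against \<open>u e / v e\<close>, and on \<open>A\<close> it turns
      \<open>u e\<close> into \<open>v e\<close>. Both cancellations rest on the nonvanishing of the
      weights.\<close>
    have weight: "(\<Prod>e\<in>?E. v e / u e) * ((\<Prod>e\<in>A. u e) * (\<Prod>e\<in>?E - A. u e / v e)) =
        (\<Prod>e\<in>A. v e)" if "A \<subseteq> ?E" for A
    proof -
      have "(\<Prod>e\<in>?E. v e / u e) = (\<Prod>e\<in>?E - A. v e / u e) * (\<Prod>e\<in>A. v e / u e)"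
        using that fin by (rule prod.subset_diff)
      moreover have "(\<Prod>e\<in>?E - A. v e / u e) * (\<Prod>e\<in>?E - A. u e / v e) = 1"
        unfolding prod.distrib[symmetric] by (rule prod.neutral) (use nz in auto)
      moreover have "(\<Prod>e\<in>A. u e) * (\<Prod>e\<in>A. v e / u e) = (\<Prod>e\<in>A. v e)"
        unfolding prod.distrib[symmetric] by (rule prod.cong) (use nz that in auto)
      ultimately show ?thesis
        by (simp add: mult.assoc mult.left_commute)
    qed
    have "(\<Sum>F\<in>Pow ?E. (\<Prod>e\<in>F. u e / v e - 1) * Potts_Z (delete_edges G F) q u) =
        (\<Sum>A\<in>Pow ?E. \<Sum>F\<in>Pow (?E - A). (\<Prod>e\<in>F. u e / v e - 1) * (q ^ ?k A * (\<Prod>e\<in>A. u e)))"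
      unfolding Potts_Z_delete_edges sum_distrib_left by (rule sum_disjoint_Pow_swap[OF fin])
    also have "\<dots> = (\<Sum>A\<in>Pow ?E. q ^ ?k A * ((\<Prod>e\<in>A. u e) * (\<Prod>e\<in>?E - A. u e / v e)))"
      unfolding sum_distrib_right[symmetric] inner by (simp add: mult_ac)
    finally have expand: "(\<Sum>F\<in>Pow ?E. (\<Prod>e\<in>F. u e / v e - 1) * Potts_Z (delete_edges G F) q u) =
        (\<Sum>A\<in>Pow ?E. q ^ ?k A * ((\<Prod>e\<in>A. u e) * (\<Prod>e\<in>?E - A. u e / v e)))" .
    show "Potts_Z G q v = (\<Prod>e\<in>?E. v e / u e) *
        (\<Sum>F\<in>Pow ?E. (\<Prod>e\<in>F. u e / v e - 1) * Potts_Z (delete_edges G F) q u)"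
      unfolding expand unfolding Potts_Z_def sum_distrib_left
      by (rule sum.cong[OF refl], subst mult.left_commute) (simp only: weight Pow_iff)
  }
  have "(\<Sum>F\<in>Pow ?E. (\<Prod>e\<in>F. v e - u e) * Potts_Z (contract_edges G F) q u) =
      (\<Sum>F\<in>Pow ?E. \<Sum>A\<in>Pow (?E - F).
        (\<Prod>e\<in>F. v e - u e) * (q ^ ?k (F \<union> A) * (\<Prod>e\<in>A. u e)))"
    by (simp add: Potts_Z_contract_edges assms sum_distrib_left)
  also have "\<dots> = (\<Sum>B\<in>Pow ?E. \<Sum>F\<in>Pow B.
      (\<Prod>e\<in>F. v e - u e) * (q ^ ?k (F \<union> (B - F)) * (\<Prod>e\<in>B - F. u e)))"
    by (rule sum_disjoint_Pow_Un[OF fin])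
  also have "\<dots> = (\<Sum>B\<in>Pow ?E. q ^ ?k B * (\<Prod>e\<in>B. v e))"
  proof (rule sum.cong[OF refl])
    fix B assume "B \<in> Pow ?E"
    then have "finite B"
      using fin finite_subset by blast
    \<comment> \<open>As \<open>F \<union> (B - F) = B\<close>, the power of \<open>q\<close> is
      constant in \<open>F\<close> and leaves the sum. What remains is the expansion of the product
      of \<open>(v e - u e) + u e\<close> over \<open>B\<close>.\<close>
    have "(\<Sum>F\<in>Pow B. (\<Prod>e\<in>F. v e - u e) * (q ^ ?k (F \<union> (B - F)) * (\<Prod>e\<in>B - F. u e))) =
        q ^ ?k B * (\<Sum>F\<in>Pow B. (\<Prod>e\<in>F. v e - u e) * (\<Prod>e\<in>B - F. u e))"
      unfolding sum_distrib_left by (intro sum.cong) (auto simp: Un_absorb1 mult_ac)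
    also have "\<dots> = q ^ ?k B * (\<Prod>e\<in>B. v e)"
      using prod_add[OF \<open>finite B\<close>, of "\<lambda>e. v e - u e" u] by simp
    finally show "(\<Sum>F\<in>Pow B. (\<Prod>e\<in>F. v e - u e) * (q ^ ?k (F \<union> (B - F)) * (\<Prod>e\<in>B - F. u e))) =
        q ^ ?k B * (\<Prod>e\<in>B. v e)" .
  qed
  finally show "Potts_Z G q v =
      (\<Sum>F\<in>Pow ?E. (\<Prod>e\<in>F. v e - u e) * Potts_Z (contract_edges G F) q u)"
    by (simp add: Potts_Z_def)
qed

end
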